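(* Let $B\ge 1$, let $x_{\rm tr}\in\mathbb{C}^B\setminus\{0\}$ be a fixed training vector, let $\sigma_x^2,\sigma_w^2>0$, and let the channel $h$ be a complex random variable with known prior distribution and $0<E[|h|^2]<\infty$. Every filter $f\in\mathbb{C}^B\setminus\{0\}$ that minimizes $\left[\mathrm{MSE}_x^{rc}(\mathrm{ZF})\right]_0$ over $\mathbb{C}^B\setminus\{0\}$ satisfies $$f^Hx_{\rm tr}=1+\frac{\sigma_w^2}{\sigma_x^2E[|h|^2]},$$ and the filter $$f_{\rm opt}^{rc\mathrm{ZF}}=\left(1+\frac{\sigma_w^2}{\sigma_x^2E[|h|^2]}\right)\frac{x_{\rm tr}}{\|x_{\rm tr}\|^2}$$ is an optimal channel estimator for (i.e., a minimizer of) $\left[\mathrm{MSE}_x^{rc}(\mathrm{ZF})\right]_0$.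
   Context: Training model: $y_{\rm tr}=h\,x_{\rm tr}+w_{\rm tr}$, where $w_{\rm tr}\in\mathbb{C}^B$ is independent of $h$ and has i.i.d. circularly symmetric complex Gaussian entries of mean $0$ and variance $\sigma_w^2$. A linear channel estimator is determined by a filter $f\in\mathbb{C}^B$ through $\hat h=f^H y_{\rm tr}$. The data symbols have mean zero and power $\sigma_x^2$. The zeroth order symbol estimate MSE of the zero-forcing equalizer for a random channel is defined, with $E_h$ the expectation over $h$ and the inner $E$ over the noise, as $$\left[\mathrm{MSE}_x^{rc}(\mathrm{ZF})\right]_0(f)=\frac{E_h\big[E[|\hat h-h|^2]\big]}{E_h\big[E[|\hat h|^2]\big]}\,\sigma_x^2+\frac{\sigma_w^2}{E_h\big[E[|\hat h|^2]\big]} =\sigma_x^2\,\frac{E[|h|^2]\,|f^Hx_{\rm tr}-1|^2+\sigma_w^2\|f\|^2+\sigma_w^2/\sigma_x^2}{E[|h|^2]\,|f^Hx_{\rm tr}|^2+\sigma_w^2\|f\|^2}.$$ *)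

theory Defs
  imports "HOL-Probability.Probability"
begin

definition herm_prod :: "complex ^ 'n::finite \<Rightarrow> complex ^ 'n \<Rightarrow> complex" where
  "herm_prod f y = (\<Sum>i\<in>UNIV. cnj (f $ i) * y $ i)"

text \<open>The law CN(0, v): real and imaginary part are independent centred real Gaussians of
  variance \<open>v / 2\<close> each (the library parametrises the normal density by the standard
  deviation).\<close>

definition circ_complex_normal :: "'a measure \<Rightarrow> ('a \<Rightarrow> complex) \<Rightarrow> real \<Rightarrow> bool" where
  "circ_complex_normal M Z v \<longleftrightarrow>
     prob_space.indep_var M borel (\<lambda>\<omega>. Re (Z \<omega>)) borel (\<lambda>\<omega>. Im (Z \<omega>)) \<and>
     distributed M lborel (\<lambda>\<omega>. Re (Z \<omega>)) (\<lambda>t. ennreal (normal_density 0 (sqrt (v / 2)) t)) \<and>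
     distributed M lborel (\<lambda>\<omega>. Im (Z \<omega>)) (\<lambda>t. ennreal (normal_density 0 (sqrt (v / 2)) t))"

text \<open>Independence of two random variables with different value types; the library's
  \<open>indep_var\<close> requires both to take values in the same type.\<close>

definition indep_rvs ::
  "'a measure \<Rightarrow> ('a \<Rightarrow> 'b::topological_space) \<Rightarrow> ('a \<Rightarrow> 'c::topological_space) \<Rightarrow> bool" where
  "indep_rvs M X Y \<longleftrightarrow>
     X \<in> borel_measurable M \<and> Y \<in> borel_measurable M \<and>
     prob_space.indep_set M {X -` A \<inter> space M | A. A \<in> sets borel}
                            {Y -` A \<inter> space M | A. A \<in> sets borel}"

definition training_obs ::
  "complex ^ 'n::finite \<Rightarrow> complex \<Rightarrow> complex ^ 'n \<Rightarrow> complex ^ 'n" where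
  "training_obs x \<eta> \<nu> = \<eta> *s x + \<nu>"

definition channel_est ::
  "complex ^ 'n::finite \<Rightarrow> complex ^ 'n \<Rightarrow> complex \<Rightarrow> complex ^ 'n \<Rightarrow> complex" where
  "channel_est f x \<eta> \<nu> = herm_prod f (training_obs x \<eta> \<nu>)"

text \<open>Outer expectation over the law of the channel, inner expectation over the law of the noise.
  For independent channel and noise this is the expectation on the underlying space,
  see \<open>expect_channel_noise_eq\<close>.\<close>

definition expect_channel_noise ::
  "'a measure \<Rightarrow> ('a \<Rightarrow> complex) \<Rightarrow> ('a \<Rightarrow> complex ^ 'n::finite) \<Rightarrow>
     (complex \<Rightarrow> complex ^ 'n \<Rightarrow> real) \<Rightarrow> real" where
  "expect_channel_noise M h w g = (LINT \<eta>|distr M borel h. (LINT \<nu>|distr M borel w. g \<eta> \<nu>))"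

definition mse_zf_rc0 ::
  "'a measure \<Rightarrow> ('a \<Rightarrow> complex) \<Rightarrow> ('a \<Rightarrow> complex ^ 'n::finite) \<Rightarrow> complex ^ 'n \<Rightarrow>
     real \<Rightarrow> real \<Rightarrow> complex ^ 'n \<Rightarrow> real" where
  "mse_zf_rc0 M h w x \<sigma>x2 \<sigma>w2 f =
     expect_channel_noise M h w (\<lambda>\<eta> \<nu>. (cmod (channel_est f x \<eta> \<nu> - \<eta>))\<^sup>2)
       / expect_channel_noise M h w (\<lambda>\<eta> \<nu>. (cmod (channel_est f x \<eta> \<nu>))\<^sup>2) * \<sigma>x2
     + \<sigma>w2 / expect_channel_noise M h w (\<lambda>\<eta> \<nu>. (cmod (channel_est f x \<eta> \<nu>))\<^sup>2)"

definition channel_power :: "'a measure \<Rightarrow> ('a \<Rightarrow> complex) \<Rightarrow> real" where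
  "channel_power M h = (LINT \<omega>|M. (cmod (h \<omega>))\<^sup>2)"

definition f_opt_rcZF ::
  "'a measure \<Rightarrow> ('a \<Rightarrow> complex) \<Rightarrow> complex ^ 'n::finite \<Rightarrow> real \<Rightarrow> real \<Rightarrow> complex ^ 'n" where
  "f_opt_rcZF M h x \<sigma>x2 \<sigma>w2 =
     (1 + \<sigma>w2 / (\<sigma>x2 * channel_power M h)) *\<^sub>R (x /\<^sub>R (norm x)\<^sup>2)"

lemma (in prob_space) indep_rvs_joint_law:
  assumes "indep_rvs M X Y"
  shows "distr M borel X \<Otimes>\<^sub>M distr M borel Y = distr M (borel \<Otimes>\<^sub>M borel) (\<lambda>\<omega>. (X \<omega>, Y \<omega>))"
proof -
  have X [measurable]: "random_variable borel X" and Y [measurable]: "random_variable borel Y"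
    and ind: "indep_set {X -` A \<inter> space M | A. A \<in> sets borel}
                        {Y -` A \<inter> space M | A. A \<in> sets borel}"
    using assms by (auto simp: indep_rvs_def)
  interpret X: prob_space "distr M borel X" by (rule prob_space_distr) simp
  interpret Y: prob_space "distr M borel Y" by (rule prob_space_distr) simp
  show ?thesis
  proof (rule pair_measure_eqI)
    fix A B assume "A \<in> sets (distr M borel X)" "B \<in> sets (distr M borel Y)"
    then have [measurable]: "A \<in> sets borel" "B \<in> sets borel" by auto
    have "prob ((X -` A \<inter> space M) \<inter> (Y -` B \<inter> space M)) =
        prob (X -` A \<inter> space M) * prob (Y -` B \<inter> space M)"
      by (rule indep_setD[OF ind]) auto
    moreover have "(\<lambda>\<omega>. (X \<omega>, Y \<omega>)) -` (A \<times> B) \<inter> space M =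
        (X -` A \<inter> space M) \<inter> (Y -` B \<inter> space M)"
      by auto
    ultimately show "emeasure (distr M borel X) A * emeasure (distr M borel Y) B =
        emeasure (distr M (borel \<Otimes>\<^sub>M borel) (\<lambda>\<omega>. (X \<omega>, Y \<omega>))) (A \<times> B)"
      by (simp add: emeasure_distr emeasure_eq_measure ennreal_mult)
  qed (auto intro: X.sigma_finite_measure_axioms Y.sigma_finite_measure_axioms
        simp: sets_pair_measure_cong[OF sets_distr sets_distr])
qed

lemma (in prob_space) expect_channel_noise_eq:
  assumes "indep_rvs M h w"
    and int: "integrable M (\<lambda>\<omega>. g (h \<omega>) (w \<omega>))"
    and g: "case_prod g \<in> borel_measurable (borel \<Otimes>\<^sub>M borel)"
  shows "expect_channel_noise M h w g = expectation (\<lambda>\<omega>. g (h \<omega>) (w \<omega>))"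
proof -
  have h [measurable]: "random_variable borel h" and w [measurable]: "random_variable borel w"
    using assms by (auto simp: indep_rvs_def)
  interpret H: prob_space "distr M borel h" by (rule prob_space_distr) simp
  interpret W: prob_space "distr M borel w" by (rule prob_space_distr) simp
  interpret HW: pair_prob_space "distr M borel h" "distr M borel w" ..
  note law = indep_rvs_joint_law[OF assms(1)]
  have "integrable (distr M borel h \<Otimes>\<^sub>M distr M borel w) (case_prod g)"
    using int g by (simp add: law integrable_distr_eq)
  then have "expect_channel_noise M h w g =
      integral\<^sup>L (distr M borel h \<Otimes>\<^sub>M distr M borel w) (case_prod g)"
    unfolding expect_channel_noise_def by (simp add: HW.integral_fst'[symmetric])
  also have "\<dots> = expectation (\<lambda>\<omega>. g (h \<omega>) (w \<omega>))"
    using g by (simp add: law integral_distr)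
  finally show ?thesis .
qed

end

theory Submission imports Defs begin

text \<open>
  Put \<open>P = E[|h|\<^sup>2]\<close>, \<open>a = f\<^sup>H x\<close>, \<open>D = P |a|\<^sup>2 + \<sigma>w2 \<parallel>f\<parallel>\<^sup>2\<close> and \<open>c = 1 + \<sigma>w2 / (\<sigma>x2 P)\<close>. Expanding
  \<open>|a - 1|\<^sup>2\<close>, the MSE is \<open>\<sigma>x2 (1 + P (c - 2 Re a) / D)\<close>, and Cauchy-Schwarz gives \<open>D \<ge> K |a|\<^sup>2\<close> with
  \<open>K = P + \<sigma>w2 / \<parallel>x\<parallel>\<^sup>2\<close>, with equality for \<open>f\<close> proportional to \<open>x\<close>. Hence the MSE exceeds its
  value at the claimed optimum by a positive multiple of \<open>c K (c - 2 Re a) + D\<close>, which is at least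
  \<open>K |a - c|\<^sup>2\<close>.
\<close>

lemma herm_prod_training_obs:
  "herm_prod f (training_obs x \<eta> \<nu>) = herm_prod f x * \<eta> + herm_prod f \<nu>"
  by (simp add: herm_prod_def training_obs_def sum.distrib sum_distrib_left algebra_simps)

lemma herm_prod_scaleR_self: "herm_prod (c *\<^sub>R x) x = complex_of_real (c * (norm x)\<^sup>2)"
proof -
  have "herm_prod (c *\<^sub>R x) x = (\<Sum>i\<in>UNIV. complex_of_real (c * (cmod (x $ i))\<^sup>2))"
    unfolding herm_prod_def
    by (intro sum.cong) (simp_all add: complex_norm_square scaleR_conv_of_real[where 'a=complex] mult_ac
        del: of_real_power)
  also have "\<dots> = complex_of_real (c * (norm x)\<^sup>2)"
    by (simp add: norm_vec_def L2_set_def sum_nonneg sum_distrib_left)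
  finally show ?thesis .
qed

text \<open>Cauchy-Schwarz, reduced by the triangle inequality to the real inequality for the moduli
  of the entries.\<close>

lemma cmod_herm_prod_le: "cmod (herm_prod f x) \<le> norm f * norm x"
proof -
  have "cmod (herm_prod f x) \<le> (\<Sum>i\<in>UNIV. \<bar>norm (f $ i)\<bar> * \<bar>norm (x $ i)\<bar>)"
    unfolding herm_prod_def by (rule order_trans[OF norm_sum]) (simp add: norm_mult)
  also have "\<dots> \<le> norm f * norm x"
    unfolding norm_vec_def by (rule L2_set_mult_ineq)
  finally show ?thesis .
qed

lemma (in prob_space) centred_normal_moments:
  assumes D: "distributed M lborel X (\<lambda>t. ennreal (normal_density 0 \<sigma> t))" and \<sigma>: "\<sigma> > 0"
  shows "has_bochner_integral M X 0" "has_bochner_integral M (\<lambda>\<omega>. (X \<omega>)\<^sup>2) (\<sigma>\<^sup>2)"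
proof -
  have 1: "integrable M X" "expectation X = 0"
    using distributed_integrable[OF D, of "\<lambda>x. x"] distributed_integral[OF D, of "\<lambda>x. x"]
      normal_moment_nz_1[OF \<sigma>, of 0] by (auto simp: has_bochner_integral_iff)
  \<comment> \<open>The \<open>1\<close> selects k = 1 in the even-moment formula
    \<open>fact (2*k) / ((2/\<sigma>\<^sup>2)^k * fact k)\<close>, whose value is then
    \<open>\<sigma>\<^sup>2\<close>.\<close>
  have 2: "integrable M (\<lambda>\<omega>. (X \<omega>)\<^sup>2)" "expectation (\<lambda>\<omega>. (X \<omega>)\<^sup>2) = \<sigma>\<^sup>2"
    using distributed_integrable[OF D, of "\<lambda>x. x\<^sup>2"] distributed_integral[OF D, of "\<lambda>x. x\<^sup>2"]
      normal_moment_even[OF \<sigma>, of 0 1] by (auto simp: has_bochner_integral_iff fact_2)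
  from 1 2 show "has_bochner_integral M X 0" "has_bochner_integral M (\<lambda>\<omega>. (X \<omega>)\<^sup>2) (\<sigma>\<^sup>2)"
    by (simp_all add: has_bochner_integral_iff)
qed

text \<open>The real and imaginary parts contribute \<open>v / 2\<close> each to the power. The
  second moment is written as \<open>Z * cnj Z\<close> so that it is the diagonal case of the
  correlation between two noise entries.\<close>

lemma (in prob_space) circ_complex_normal_moments:
  assumes Z: "circ_complex_normal M Z v" and v: "v > 0"
  shows "has_bochner_integral M Z 0"
    "has_bochner_integral M (\<lambda>\<omega>. Z \<omega> * cnj (Z \<omega>)) (complex_of_real v)"
proof -
  have s: "sqrt (v / 2) > 0" using v by simp
  note D = Z[unfolded circ_complex_normal_def, THEN conjunct2]
  note R = centred_normal_moments[OF D[THEN conjunct1] s]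
  note I = centred_normal_moments[OF D[THEN conjunct2] s]
  have "has_bochner_integral M
      (\<lambda>\<omega>. complex_of_real (Re (Z \<omega>)) + \<i> * complex_of_real (Im (Z \<omega>)))
      (complex_of_real 0 + \<i> * complex_of_real 0)"
    by (intro has_bochner_integral_add has_bochner_integral_mult_right
          has_bochner_integral_of_real R(1) I(1))
  then show "has_bochner_integral M Z 0"
    by (simp flip: complex_eq)
  have "has_bochner_integral M (\<lambda>\<omega>. complex_of_real ((Re (Z \<omega>))\<^sup>2 + (Im (Z \<omega>))\<^sup>2))
      (complex_of_real ((sqrt (v / 2))\<^sup>2 + (sqrt (v / 2))\<^sup>2))"
    by (intro has_bochner_integral_of_real has_bochner_integral_add R(2) I(2))
  then show "has_bochner_integral M (\<lambda>\<omega>. Z \<omega> * cnj (Z \<omega>)) (complex_of_real v)"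
    using v by (simp add: complex_mult_cnj del: of_real_add)
qed

lemma (in prob_space) indep_vars_expectation_mult_cnj:
  fixes W :: "'i \<Rightarrow> 'a \<Rightarrow> complex"
  assumes ind: "indep_vars (\<lambda>_. borel) W {i, j}" and ne: "i \<noteq> j"
    and int: "integrable M (W i)" "integrable M (W j)"
  shows "has_bochner_integral M (\<lambda>\<omega>. W i \<omega> * cnj (W j \<omega>))
    (expectation (W i) * cnj (expectation (W j)))"
proof -
  \<comment> \<open>Conjugating only the entry \<open>j\<close> makes the product over
    \<open>{i, j}\<close> the wanted integrand, and independence survives this entrywise
    transformation.\<close>
  define g where "g k = (if k = j then cnj else (\<lambda>z. z))" for k
  have g: "g k \<in> borel_measurable borel" for k
    by (auto simp: g_def intro!: borel_measurable_continuous_onI continuous_intros)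
  have ind': "indep_vars (\<lambda>_. borel) (\<lambda>k \<omega>. g k (W k \<omega>)) {i, j}"
    by (rule indep_vars_compose2[OF ind]) (rule g)
  have int': "integrable M (\<lambda>\<omega>. g k (W k \<omega>))" if "k \<in> {i, j}" for k
    using that int by (auto simp: g_def)
  show ?thesis
    using indep_vars_lebesgue_integral[OF _ ind' int'] indep_vars_integrable[OF _ ind' int'] ne
    by (simp add: g_def has_bochner_integral_iff)
qed

text \<open>The squared modulus expands into a double sum over pairs of noise entries. Off-diagonal
  pairs have mean 0 by independence and centring; the diagonal ones leave \<open>v\<close> times the
  squared moduli of the entries of \<open>f\<close>.\<close>

lemma (in prob_space) herm_prod_noise_moments:
  fixes w :: "'a \<Rightarrow> complex ^ 'n::finite"
  assumes ind: "indep_vars (\<lambda>_. borel) (\<lambda>i \<omega>. w \<omega> $ i) UNIV"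
    and Z: "\<And>i. circ_complex_normal M (\<lambda>\<omega>. w \<omega> $ i) v" and v: "v > 0"
  shows "has_bochner_integral M (\<lambda>\<omega>. herm_prod f (w \<omega>)) 0"
    "has_bochner_integral M (\<lambda>\<omega>. (cmod (herm_prod f (w \<omega>)))\<^sup>2) (v * (norm f)\<^sup>2)"
proof -
  note mean = circ_complex_normal_moments(1)[OF Z v]
  note var = circ_complex_normal_moments(2)[OF Z v]
  have "has_bochner_integral M (\<lambda>\<omega>. \<Sum>i\<in>UNIV. cnj (f $ i) * w \<omega> $ i) (\<Sum>i\<in>UNIV. cnj (f $ i) * 0)"
    by (intro has_bochner_integral_sum has_bochner_integral_mult_right mean)
  then show "has_bochner_integral M (\<lambda>\<omega>. herm_prod f (w \<omega>)) 0"
    by (simp add: herm_prod_def)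
  have corr: "has_bochner_integral M (\<lambda>\<omega>. w \<omega> $ i * cnj (w \<omega> $ j))
      (if i = j then complex_of_real v else 0)" for i j
  proof (cases "i = j")
    case False
    have "indep_vars (\<lambda>_. borel) (\<lambda>i \<omega>. w \<omega> $ i) {i, j}"
      by (rule indep_vars_subset[OF ind]) simp
    from indep_vars_expectation_mult_cnj[OF this False] mean[of i] mean[of j] False
    show ?thesis by (simp add: has_bochner_integral_iff)
  qed (use var in simp)
  have eq: "complex_of_real ((cmod (herm_prod f y))\<^sup>2) =
      (\<Sum>i\<in>UNIV. \<Sum>j\<in>UNIV. (cnj (f $ i) * f $ j) * (y $ i * cnj (y $ j)))" for y
    unfolding complex_norm_square herm_prod_def cnj_sum sum_product
    by (simp add: algebra_simps)
  have "has_bochner_integral M (\<lambda>\<omega>. complex_of_real ((cmod (herm_prod f (w \<omega>)))\<^sup>2))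
      (\<Sum>i\<in>UNIV. \<Sum>j\<in>UNIV. (cnj (f $ i) * f $ j) * (if i = j then complex_of_real v else 0))"
    unfolding eq by (intro has_bochner_integral_sum has_bochner_integral_mult_right corr)
  also have "(\<Sum>i\<in>UNIV. \<Sum>j\<in>UNIV. (cnj (f $ i) * f $ j) * (if i = j then complex_of_real v else 0))
      = (\<Sum>i\<in>UNIV. complex_of_real (v * (cmod (f $ i))\<^sup>2))"
    by (simp add: if_distrib[where f="\<lambda>z. _ * z"] complex_norm_square mult_ac
        del: of_real_power cong: if_cong)
  also have "\<dots> = complex_of_real (v * (norm f)\<^sup>2)"
    by (simp add: norm_vec_def L2_set_def sum_nonneg sum_distrib_left)
  \<comment> \<open>The double sum has complex terms, so the moment was computed in the complex
    numbers; taking real parts brings it back.\<close>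
  finally show "has_bochner_integral M (\<lambda>\<omega>. (cmod (herm_prod f (w \<omega>)))\<^sup>2) (v * (norm f)\<^sup>2)"
    using has_bochner_integral_bounded_linear[OF bounded_linear_Re] by force
qed

text \<open>The cross term is real-linear in \<open>Z\<close>, so it vanishes in the mean.\<close>

lemma (in prob_space) has_bochner_integral_cmod_add_centred_sq:
  assumes Z: "has_bochner_integral M Z 0"
    and Z2: "has_bochner_integral M (\<lambda>\<omega>. (cmod (Z \<omega>))\<^sup>2) N"
  shows "has_bochner_integral M (\<lambda>\<omega>. (cmod (c + Z \<omega>))\<^sup>2) ((cmod c)\<^sup>2 + N)"
proof -
  have eq: "(cmod (c + z))\<^sup>2 = (cmod c)\<^sup>2 + 2 * Re (cnj c * z) + (cmod z)\<^sup>2" for z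
    unfolding cmod_power2 by (simp add: power2_eq_square algebra_simps)
  have const: "has_bochner_integral M (\<lambda>_. (cmod c)\<^sup>2) ((cmod c)\<^sup>2)"
    by (simp add: has_bochner_integral_iff prob_space)
  have "has_bochner_integral M (\<lambda>\<omega>. (cmod (c + Z \<omega>))\<^sup>2) ((cmod c)\<^sup>2 + 2 * Re (cnj c * 0) + N)"
    unfolding eq
    by (intro has_bochner_integral_add has_bochner_integral_mult_right
          has_bochner_integral_bounded_linear[OF bounded_linear_Re] const Z Z2)
  then show ?thesis by simp
qed

lemma herm_prod_measurable: "herm_prod f \<in> borel_measurable borel"
  unfolding herm_prod_def[abs_def]
  by (intro borel_measurable_continuous_onI continuous_intros)

text \<open>Covers numerator and denominator of the MSE at once: both the estimation error and the
  estimate are affine in the noise. In the inner integral \<open>\<eta>\<close> is fixed, so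
  \<open>k * \<eta>\<close> is the constant added to centred noise.\<close>

lemma (in prob_space) expect_channel_noise_affine:
  fixes w :: "'a \<Rightarrow> complex ^ 'n::finite"
  assumes h [measurable]: "h \<in> borel_measurable M" and w [measurable]: "w \<in> borel_measurable M"
    and h2: "integrable M (\<lambda>\<omega>. (cmod (h \<omega>))\<^sup>2)"
    and ind: "indep_vars (\<lambda>_. borel) (\<lambda>i \<omega>. w \<omega> $ i) UNIV"
    and Z: "\<And>i. circ_complex_normal M (\<lambda>\<omega>. w \<omega> $ i) v" and v: "v > 0"
  shows "expect_channel_noise M h w (\<lambda>\<eta> \<nu>. (cmod (k * \<eta> + herm_prod f \<nu>))\<^sup>2) =
    channel_power M h * (cmod k)\<^sup>2 + v * (norm f)\<^sup>2"
proof -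
  note [measurable] = herm_prod_measurable[of f]
  have inner: "(LINT \<nu>|distr M borel w. (cmod (k * \<eta> + herm_prod f \<nu>))\<^sup>2) =
      (cmod k)\<^sup>2 * (cmod \<eta>)\<^sup>2 + v * (norm f)\<^sup>2" for \<eta>
  proof -
    have "(LINT \<nu>|distr M borel w. (cmod (k * \<eta> + herm_prod f \<nu>))\<^sup>2) =
        expectation (\<lambda>\<omega>. (cmod (k * \<eta> + herm_prod f (w \<omega>)))\<^sup>2)"
      by (rule integral_distr) measurable
    also have "\<dots> = (cmod (k * \<eta>))\<^sup>2 + v * (norm f)\<^sup>2"
      using has_bochner_integral_cmod_add_centred_sq[OF herm_prod_noise_moments[OF ind Z v]]
      by (rule has_bochner_integral_integral_eq)
    finally show ?thesis by (simp add: norm_mult power_mult_distrib)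
  qed
  have "expect_channel_noise M h w (\<lambda>\<eta> \<nu>. (cmod (k * \<eta> + herm_prod f \<nu>))\<^sup>2) =
      expectation (\<lambda>\<omega>. (cmod k)\<^sup>2 * (cmod (h \<omega>))\<^sup>2 + v * (norm f)\<^sup>2)"
    unfolding expect_channel_noise_def inner by (rule integral_distr) measurable
  also have "\<dots> = channel_power M h * (cmod k)\<^sup>2 + v * (norm f)\<^sup>2"
    using h2 by (simp add: channel_power_def prob_space)
  finally show ?thesis .
qed

theorem mainTheorem4:
  fixes M :: "'a measure"
    and h :: "'a \<Rightarrow> complex"
    and w :: "'a \<Rightarrow> complex ^ 'n::finite"
    and x_tr :: "complex ^ 'n"
    and \<sigma>x2 \<sigma>w2 :: real
  assumes "prob_space M"
    and "x_tr \<noteq> 0"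
    and "\<sigma>x2 > 0" and "\<sigma>w2 > 0"
    and "h \<in> borel_measurable M"
    and "integrable M (\<lambda>\<omega>. (cmod (h \<omega>))\<^sup>2)"
    and "channel_power M h > 0"
    and "w \<in> borel_measurable M"
    and "indep_rvs M h w"
    and "prob_space.indep_vars M (\<lambda>_. borel) (\<lambda>i \<omega>. w \<omega> $ i) UNIV"
    and "\<And>i. circ_complex_normal M (\<lambda>\<omega>. w \<omega> $ i) \<sigma>w2"
  shows "(\<forall>f. is_arg_min (mse_zf_rc0 M h w x_tr \<sigma>x2 \<sigma>w2) (\<lambda>f. f \<noteq> 0) f \<longrightarrow>
              herm_prod f x_tr = complex_of_real (1 + \<sigma>w2 / (\<sigma>x2 * channel_power M h)))
         \<and> is_arg_min (mse_zf_rc0 M h w x_tr \<sigma>x2 \<sigma>w2) (\<lambda>f. f \<noteq> 0)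
              (f_opt_rcZF M h x_tr \<sigma>x2 \<sigma>w2)"
proof -
  interpret prob_space M by fact
  define P where "P = channel_power M h"
  define c where "c = 1 + \<sigma>w2 / (\<sigma>x2 * P)"
  define K where "K = P + \<sigma>w2 / (norm x_tr)\<^sup>2"
  define a where "a f = herm_prod f x_tr" for f
  define D where "D f = P * (cmod (a f))\<^sup>2 + \<sigma>w2 * (norm f)\<^sup>2" for f :: "complex ^ 'n"
  define J where "J = mse_zf_rc0 M h w x_tr \<sigma>x2 \<sigma>w2"
  define g where "g = f_opt_rcZF M h x_tr \<sigma>x2 \<sigma>w2"
  have pos: "P > 0" "\<sigma>x2 > 0" "\<sigma>w2 > 0" "norm x_tr > 0"
    using assms by (simp_all add: P_def)
  then have c: "c > 0" and K: "K > 0"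
    by (auto simp: c_def K_def intro!: add_pos_pos)
  \<comment> \<open>The noise term alone keeps the denominator positive, even where
    \<open>a f = 0\<close>.\<close>
  have D: "D f > 0" if "f \<noteq> 0" for f
    using that pos by (auto simp: D_def intro!: add_nonneg_pos)
  have K_le_D: "K * (cmod (a f))\<^sup>2 \<le> D f" for f
  proof -
    have "(cmod (a f))\<^sup>2 \<le> (norm f * norm x_tr)\<^sup>2"
      unfolding a_def by (intro power_mono cmod_herm_prod_le) simp
    then have "(cmod (a f))\<^sup>2 / (norm x_tr)\<^sup>2 \<le> (norm f)\<^sup>2"
      using pos by (simp add: power_mult_distrib divide_le_eq)
    from mult_left_mono[OF this, of \<sigma>w2] show ?thesis
      using pos by (simp add: K_def D_def algebra_simps)
  qed
  note power = expect_channel_noise_affine[OF assms(5,8,6,10,11,4)]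
  have J: "J f = \<sigma>x2 * (1 + P * (c - 2 * Re (a f)) / D f)" if "f \<noteq> 0" for f
  proof -
    have err: "channel_est f x_tr \<eta> \<nu> - \<eta> = (a f - 1) * \<eta> + herm_prod f \<nu>"
      and est: "channel_est f x_tr \<eta> \<nu> = a f * \<eta> + herm_prod f \<nu>" for \<eta> \<nu>
      by (simp_all add: channel_est_def herm_prod_training_obs a_def algebra_simps)
    have "J f = (P * (cmod (a f - 1))\<^sup>2 + \<sigma>w2 * (norm f)\<^sup>2) / D f * \<sigma>x2 + \<sigma>w2 / D f"
      \<comment> \<open>\<open>err\<close> has to be applied before \<open>est\<close>, which would
        otherwise rewrite inside its left-hand side. Then \<open>power\<close> is used with
        \<open>k = a f - 1\<close> and with \<open>k = a f\<close>.\<close>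
      unfolding J_def mse_zf_rc0_def err unfolding est power by (simp add: D_def P_def)
    also have "\<dots> = \<sigma>x2 * ((D f + P * (c - 2 * Re (a f))) / D f)"
    proof -
      have sq: "(cmod (a f - 1))\<^sup>2 = (cmod (a f))\<^sup>2 - 2 * Re (a f) + 1"
        unfolding cmod_power2 by (simp add: power2_eq_square algebra_simps)
      \<comment> \<open>The definition of \<open>c\<close> solved for the noise variance: the
        separate noise summand of the MSE is thereby absorbed into the linear term in
        \<open>Re (a f)\<close>.\<close>
      have "\<sigma>w2 = \<sigma>x2 * (P * c - P)"
        using pos by (simp add: c_def field_simps)
      then have "(P * (cmod (a f - 1))\<^sup>2 + \<sigma>w2 * (norm f)\<^sup>2) * \<sigma>x2 + \<sigma>w2 =
          \<sigma>x2 * (D f + P * (c - 2 * Re (a f)))"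
        unfolding sq D_def by (simp add: algebra_simps)
      then show ?thesis by (simp flip: add_divide_distrib)
    qed
    finally show ?thesis using D[OF that] by (simp add: field_simps)
  qed
  have "g = (c / (norm x_tr)\<^sup>2) *\<^sub>R x_tr"
    by (simp add: g_def f_opt_rcZF_def c_def P_def divide_inverse)
  then have g: "g \<noteq> 0" "a g = complex_of_real c" "norm g = c / norm x_tr"
    using c pos by (simp_all add: a_def herm_prod_scaleR_self power2_eq_square)
  \<comment> \<open>Equality case of \<open>K_le_D\<close>, as \<open>g\<close> is a multiple of
    \<open>x_tr\<close>.\<close>
  have "D g = c\<^sup>2 * K"
    using pos c by (simp add: D_def g K_def power_divide algebra_simps)
  then have Jg: "J g = \<sigma>x2 * (1 - P / (c * K))"
    using J[OF g(1)] c by (simp add: g power2_eq_square)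
  \<comment> \<open>After \<open>D f\<close> is bounded below by
    \<open>K * (cmod (a f))\<^sup>2\<close>, completing the square gives exactly the left-hand
    side.\<close>
  have excess: "K * (cmod (a f - complex_of_real c))\<^sup>2 \<le> c * K * (c - 2 * Re (a f)) + D f" for f
  proof -
    have sq: "(cmod (a f - complex_of_real c))\<^sup>2 = (cmod (a f))\<^sup>2 + c * (c - 2 * Re (a f))"
      unfolding cmod_power2 by (simp add: power2_eq_square algebra_simps)
    show ?thesis using K_le_D[of f] unfolding sq by (simp add: algebra_simps)
  qed
  have diff: "J f - J g = \<sigma>x2 * P / (c * K * D f) * (c * K * (c - 2 * Re (a f)) + D f)"
    if "f \<noteq> 0" for f
    unfolding J[OF that] Jg using D[OF that] c K by (simp add: field_simps)
  have fac: "\<sigma>x2 * P / (c * K * D f) > 0" if "f \<noteq> 0" for f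
    using D[OF that] c K pos by simp
  have min: "J g \<le> J f" if "f \<noteq> 0" for f
  proof -
    have "0 \<le> c * K * (c - 2 * Re (a f)) + D f"
      using K by (intro order_trans[OF _ excess]) simp
    with fac[OF that] have "0 \<le> J f - J g"
      unfolding diff[OF that] by (intro mult_nonneg_nonneg) auto
    then show ?thesis by simp
  qed
  \<comment> \<open>Doing at least as well as \<open>g\<close> forces the excess to be nonpositive,
    so the square below it vanishes.\<close>
  have "a f = complex_of_real c" if "f \<noteq> 0" "J f \<le> J g" for f
  proof -
    have "c * K * (c - 2 * Re (a f)) + D f \<le> 0"
      using that(2) diff[OF that(1)] fac[OF that(1)]
      by (metis diff_le_0_iff_le mult_le_0_iff not_less)
    with excess[of f] have "K * (cmod (a f - complex_of_real c))\<^sup>2 \<le> 0" by linarith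
    then show ?thesis using K by (simp add: mult_le_0_iff)
  qed
  \<comment> \<open>\<open>is_arg_min\<close> says that no admissible filter is strictly better; for
    a minimizer \<open>f\<close>, taking \<open>g\<close> as competitor gives
    \<open>J f \<le> J g\<close>.\<close>
  then show ?thesis
    using min g(1) unfolding is_arg_min_def J_def[symmetric] g_def[symmetric]
    by (auto simp: a_def c_def P_def not_less)
qed

end
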